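(* Let $G=(V,E)$ be a connected (claw, net)-free graph and $t\in V$. Then $t$ is the last vertex of some DFS ordering of $G$ if and only if $t$ is not a cut vertex of $G$.
   Context: A claw is the graph consisting of one vertex adjacent to three pairwise nonadjacent vertices of degree one. A net consists of a triangle whose three vertices are each adjacent to a distinct additional vertex of degree one. A graph is $H$-free if it contains no induced subgraph isomorphic to $H$. A cut vertex is a vertex whose removal disconnects the graph. A DFS (depth first search) ordering is an ordering obtained by starting at an arbitrary vertex and, at each step, visiting next an unvisited neighbour of the most recently visited vertex that still has an unvisited neighbour (backtracking as needed), with arbitrary tie-breaks. *)

theory Defs
  imports "Graph_Theory.Digraph_Isomorphism"
begin

text \<open>
  Finite simple graphs are modelled as in \<^theory>\<open>Graph_Theory.Digraph\<close>: \<^locale>\<open>graph\<close> is a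
  finite loop-free symmetric digraph without parallel arcs, so each edge is a pair of opposite arcs.
\<close>

definition claw :: "nat pair_pre_digraph" where
  "claw = \<lparr> pverts = {0, 1, 2, 3},
            parcs = (let E = {(0, 1), (0, 2), (0, 3)} in E \<union> E\<inverse>) \<rparr>"

text \<open>The triangle is \<open>0, 1, 2\<close>; its pendant neighbours are \<open>3, 4, 5\<close> respectively.\<close>

definition net :: "nat pair_pre_digraph" where
  "net = \<lparr> pverts = {0, 1, 2, 3, 4, 5},
           parcs = (let E = {(0, 1), (0, 2), (1, 2), (0, 3), (1, 4), (2, 5)} in E \<union> E\<inverse>) \<rparr>"

lemma pair_graph_claw: "pair_graph claw"
  by unfold_locales (auto simp: claw_def symmetric_def sym_def)

lemma pair_graph_net: "pair_graph net"
  by unfold_locales (auto simp: net_def symmetric_def sym_def)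

definition induced_free :: "('c, 'd) pre_digraph \<Rightarrow> ('a, 'b) pre_digraph \<Rightarrow> bool" where
  "induced_free H G \<longleftrightarrow> \<not> (\<exists>S. induced_subgraph S G \<and> digraph_iso S H)"

text \<open>
  The library's \<^const>\<open>connected\<close> excludes the null graph, whereas removing the only vertex
  of a one-vertex graph does not disconnect it; hence the condition that a vertex remains.
  The notion is intended for connected \<open>G\<close>.
\<close>

definition cut_vertex :: "('a, 'b) pre_digraph \<Rightarrow> 'a \<Rightarrow> bool" where
  "cut_vertex G v \<longleftrightarrow> v \<in> verts G \<and>
     verts (pre_digraph.del_vert G v) \<noteq> {} \<and> \<not> connected (pre_digraph.del_vert G v)"

text \<open>
  \<open>dfs_visited G xs\<close>: some depth first search of \<open>G\<close> has so far visited exactly the vertices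
  in \<open>xs\<close>, listed in the order of their first visit. In the rule \<open>step\<close>, \<open>y\<close> is the most recently
  visited vertex that still has an unvisited neighbour: everything in \<open>ys\<close> was visited after \<open>y\<close>
  and has none. Tie-breaks are arbitrary because \<open>z\<close> may be any unvisited neighbour of \<open>y\<close>.
\<close>

inductive dfs_visited :: "('a, 'b) pre_digraph \<Rightarrow> 'a list \<Rightarrow> bool" for G where
  start: "s \<in> verts G \<Longrightarrow> dfs_visited G [s]"
| step: "\<lbrakk> dfs_visited G (xs @ y # ys);
           \<forall>u \<in> set ys. \<forall>w. u \<rightarrow>\<^bsub>G\<^esub> w \<longrightarrow> w \<in> set (xs @ y # ys);
           y \<rightarrow>\<^bsub>G\<^esub> z; z \<notin> set (xs @ y # ys) \<rbrakk>
         \<Longrightarrow> dfs_visited G (xs @ y # ys @ [z])"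

definition dfs_ordering :: "('a, 'b) pre_digraph \<Rightarrow> 'a list \<Rightarrow> bool" where
  "dfs_ordering G xs \<longleftrightarrow> dfs_visited G xs \<and> set xs = verts G"

end

theory Submission
  imports Defs
begin

text \<open>
  A prefix of a depth first search induces a connected graph, so its last vertex is never a cut
  vertex. Conversely, \<open>t\<close> comes last in some search as soon as there is a path ending in \<open>t\<close> that
  contains all neighbours of \<open>t\<close>: descend along the path, exhausting at each vertex the components
  of the unvisited vertices that are cut off from the rest of the path. If \<open>t\<close> is not a cut
  vertex, such a path exists because, by claw-freeness, among any three neighbours of \<open>t\<close> two are
  adjacent. Among the paths of \<open>G - t\<close> with both ends in the neighbourhood of \<open>t\<close>, take one
  containing as many neighbours as possible. A missed neighbour is adjacent to neither end, so the
  ends are adjacent and close the path to a cycle; opening this cycle where a path from the missed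
  neighbour first meets it gives a better path.
\<close>

section \<open>Connectivity and claws in symmetric digraphs\<close>

text \<open>The symmetric closure behind \<open>connected\<close> adds nothing to reachability in a
  symmetric digraph, so connectivity can be handled through \<open>rtrancl\<close> of a plain
  relation on vertices.\<close>

lemma symmetric_connected_iff:
  assumes "wf_digraph G" "symmetric G"
  shows "connected G \<longleftrightarrow>
    verts G \<noteq> {} \<and> (\<forall>u \<in> verts G. \<forall>v \<in> verts G. (u, v) \<in> (arcs_ends G)\<^sup>*)"
  using assms wf_digraph.reachable_conv'[OF assms(1)]
    wf_digraph.reachable_mk_symmetric_eq[OF assms]
  by (simp add: connected_def strongly_connected_def)

lemma (in wf_digraph) symmetric_del_vert: "symmetric G \<Longrightarrow> symmetric (del_vert v)"
  unfolding symmetric_conv del_vert_simps by fastforce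

lemma arcs_ends_del_vert:
  "arcs_ends (pre_digraph.del_vert G v) = {(x, y). x \<rightarrow>\<^bsub>G\<^esub> y \<and> x \<noteq> v \<and> y \<noteq> v}"
  by (auto simp: arcs_ends_conv pre_digraph.del_vert_simps)

text \<open>Three pairwise nonadjacent neighbours of \<open>c\<close> would induce a claw with
  centre \<open>c\<close>; the isomorphism is written down explicitly.\<close>

lemma (in graph) claw_free_neighbours:
  assumes "induced_free (with_proj claw) G"
    and "c \<rightarrow> x" "c \<rightarrow> y" "c \<rightarrow> z" "x \<noteq> y" "y \<noteq> z" "x \<noteq> z"
  shows "x \<rightarrow> y \<or> y \<rightarrow> z \<or> x \<rightarrow> z"
proof (rule ccontr)
  assume *: "\<not> ?thesis"
  have sym: "u \<rightarrow> v \<longleftrightarrow> v \<rightarrow> u" for u v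
    using arcs_ends_symmetric[OF sym_arcs] by blast
  have irrefl: "\<not> u \<rightarrow> u" for u
    using adj_not_same by blast
  have cne: "c \<noteq> x" "c \<noteq> y" "c \<noteq> z"
    using assms irrefl by auto
  let ?S = "{c, x, y, z}"
  have S: "?S \<subseteq> verts G"
    using assms adj_in_verts by blast
  define f :: "'a \<Rightarrow> nat"
    where "f u = (if u = c then 0 else if u = x then 1 else if u = y then 2 else 3)" for u
  have f: "f c = 0" "f x = 1" "f y = 2" "f z = 3"
    using assms cne by (auto simp: f_def)
  have inj: "inj_on f ?S"
    by (auto simp: inj_on_def f)
  let ?H = "G \<restriction> ?S"
  \<comment> \<open>In \<open>with_proj claw\<close> an arc is the pair of its ends, so each arc
    must go to the pair of the images of its ends.\<close>
  let ?h = "\<lparr> iso_verts = f, iso_arcs = \<lambda>e. (f (tail G e), f (head G e)),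
              iso_head = snd, iso_tail = fst \<rparr>"
  have ind: "induced_subgraph ?H G"
    using S by (rule induced_induce)
  have ends: "arcs_ends ?H = arcs_ends G \<inter> ?S \<times> ?S"
    by (auto simp: arcs_ends_conv induce_subgraph_def)
  have "inj_on (iso_arcs ?h) (arcs ?H)"
  proof (rule inj_onI)
    fix a b assume ab: "a \<in> arcs ?H" "b \<in> arcs ?H" "iso_arcs ?h a = iso_arcs ?h b"
    then have "tail G a \<in> ?S" "tail G b \<in> ?S" "head G a \<in> ?S" "head G b \<in> ?S"
      "f (tail G a) = f (tail G b)" "f (head G a) = f (head G b)"
      by simp_all
    then have "tail G a = tail G b" "head G a = head G b"
      using inj_onD[OF inj] by metis+
    then show "a = b"
      using ab no_multi_arcs[of a b] by (auto simp: arc_to_ends_def)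
  qed
  then have iso: "pre_digraph.digraph_isomorphism ?H ?h"
    using inj S wf_digraphI_induced unfolding pre_digraph.digraph_isomorphism_def
    by auto
  have "iso_arcs ?h ` arcs ?H = map_prod f f ` arcs_ends ?H"
    by (auto simp: arcs_ends_conv image_image)
  also have "arcs_ends ?H = {(c, x), (c, y), (c, z), (x, c), (y, c), (z, c)}"
    unfolding ends using * assms(2-4) irrefl sym by auto
  finally have "iso_arcs ?h ` arcs ?H = parcs claw"
    using f by (auto simp: claw_def Let_def)
  moreover have "iso_verts ?h ` verts ?H = pverts claw"
    using f by (auto simp: claw_def)
  ultimately have "with_proj claw = app_iso ?h ?H"
    by (intro pre_digraph.equality) auto
  with iso ind assms(1) show False
    unfolding induced_free_def digraph_iso_def by blast
qed

section \<open>Paths through prescribed vertices\<close>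

text \<open>A walk into \<open>X\<close> is cut at its first entry \<open>q\<close>, and repetitions
  are removed. The path \<open>ws\<close> stops just before \<open>q\<close>, so it can be joined to
  a path inside \<open>X\<close>.\<close>

lemma rtrancl_path_to_set:
  assumes "(v, p) \<in> E\<^sup>*" "p \<in> X" "v \<notin> X"
  obtains ws q where "ws \<noteq> []" "hd ws = v" "distinct ws" "set ws \<inter> X = {}"
    "successively (\<lambda>x y. (x, y) \<in> E) ws" "(last ws, q) \<in> E" "q \<in> X"
proof -
  have "v \<notin> X \<longrightarrow> (\<exists>ws q. ws \<noteq> [] \<and> hd ws = v \<and> distinct ws \<and> set ws \<inter> X = {} \<and>
     successively (\<lambda>x y. (x, y) \<in> E) ws \<and> (last ws, q) \<in> E \<and> q \<in> X)"
    using assms(1)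
  proof (induction rule: converse_rtrancl_induct)
    case base
    then show ?case using assms(2) by blast
  next
    case (step v v')
    show ?case
    proof
      assume v: "v \<notin> X"
      show "\<exists>ws q. ws \<noteq> [] \<and> hd ws = v \<and> distinct ws \<and> set ws \<inter> X = {} \<and>
        successively (\<lambda>x y. (x, y) \<in> E) ws \<and> (last ws, q) \<in> E \<and> q \<in> X"
      proof (cases "v' \<in> X")
        case True
        then show ?thesis using v step(1) by (intro exI[of _ "[v]"] exI[of _ v']) auto
      next
        case False
        with step(3) obtain ws q where ws: "ws \<noteq> []" "hd ws = v'" "distinct ws"
          "set ws \<inter> X = {}" "successively (\<lambda>x y. (x, y) \<in> E) ws" "(last ws, q) \<in> E" "q \<in> X"
          by blast
        show ?thesis
        \<comment> \<open>If \<open>v\<close> recurs on the path from \<open>v'\<close>, the part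
          from that occurrence on already serves.\<close>
        proof (cases "v \<in> set ws")
          case True
          then obtain as bs where "ws = as @ v # bs" by (meson split_list)
          then show ?thesis using ws
            by (intro exI[of _ "v # bs"] exI[of _ q]) (auto simp: successively_append_iff)
        next
          case False
          then show ?thesis using ws v step(1)
            by (intro exI[of _ "v # ws"] exI[of _ q]) (auto simp: successively_Cons)
        qed
      qed
    qed
  qed
  with assms(3) that show thesis by blast
qed

text \<open>Meant for the arcs of \<open>G - t\<close> and the neighbourhood \<open>A\<close> of
  \<open>t\<close>; \<open>indep\<close>, which excludes three pairwise nonadjacent vertices in
  \<open>A\<close>, is what claw-freeness supplies.\<close>

lemma path_through_set:
  assumes "finite A" "A \<noteq> {}" and conn: "\<And>x y. x \<in> A \<Longrightarrow> y \<in> A \<Longrightarrow> (x, y) \<in> E\<^sup>*"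
    and "sym E"
    and indep: "\<And>x y z. \<lbrakk>x \<in> A; y \<in> A; z \<in> A; x \<noteq> y; y \<noteq> z; x \<noteq> z\<rbrakk>
           \<Longrightarrow> (x, y) \<in> E \<or> (y, z) \<in> E \<or> (x, z) \<in> E"
  obtains ps where "ps \<noteq> []" "distinct ps" "successively (\<lambda>x y. (x, y) \<in> E) ps"
    "A \<subseteq> set ps" "last ps \<in> A"
proof -
  \<comment> \<open>Both ends are kept in \<open>A\<close> so that \<open>indep\<close> applies to
    them together with a missed vertex.\<close>
  define P where "P ps \<longleftrightarrow> ps \<noteq> [] \<and> distinct ps \<and> successively (\<lambda>x y. (x, y) \<in> E) ps \<and>
    hd ps \<in> A \<and> last ps \<in> A" for ps
  obtain a where "a \<in> A" using assms by blast
  then have "P [a]" by (simp add: P_def)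
  moreover have "\<forall>ps. P ps \<longrightarrow> card (set ps \<inter> A) < Suc (card A)"
    using assms(1) by (simp add: card_mono le_imp_less_Suc)
  ultimately obtain ps where ps: "P ps"
    and max: "\<And>ps'. P ps' \<Longrightarrow> card (set ps' \<inter> A) \<le> card (set ps \<inter> A)"
    using ex_has_greatest_nat[of P "[a]" "\<lambda>ps. card (set ps \<inter> A)"] by blast
  have no_ext: False if "P ps'" "insert v (set ps \<inter> A) \<subseteq> set ps'" "v \<in> A" "v \<notin> set ps" for ps' v
  proof -
    have "card (set ps \<inter> A) < card (set ps' \<inter> A)"
      using that assms(1) by (intro psubset_card_mono) auto
    with max[OF that(1)] show False by simp
  qed
  have "v \<in> set ps" if v: "v \<in> A" for v
  proof (rule ccontr)
    assume nv: "v \<notin> set ps"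
    \<comment> \<open>Otherwise \<open>v\<close> could be attached at that end, against
      maximality.\<close>
    have 1: "(v, hd ps) \<notin> E"
      using no_ext[of "v # ps" v] ps v nv by (auto simp: P_def successively_Cons)
    have 2: "(last ps, v) \<notin> E"
      using no_ext[of "ps @ [v]" v] ps v nv by (auto simp: P_def successively_append_iff)
    have cyc: "(last ps, hd ps) \<in> E" if "hd ps \<noteq> last ps"
      using indep[of "last ps" "hd ps" v] that ps v nv 1 2 \<open>sym E\<close>
      by (metis P_def hd_in_set last_in_set symE)
    have "hd ps \<in> set ps" "hd ps \<in> A" using ps by (auto simp: P_def)
    then obtain ws q where ws: "ws \<noteq> []" "hd ws = v" "distinct ws" "set ws \<inter> set ps = {}"
      "successively (\<lambda>x y. (x, y) \<in> E) ws" "(last ws, q) \<in> E" "q \<in> set ps"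
      using rtrancl_path_to_set[OF conn[OF v] _ nv] by metis
    obtain as bs where split: "ps = as @ q # bs"
      using ws(7) by (meson split_list)
    \<comment> \<open>Opening the cycle at \<open>q\<close>; the part after the last vertex in \<open>A\<close> is cut off below.\<close>
    let ?zs = "ws @ q # bs @ as"
    \<comment> \<open>The seam is the edge closing the cycle. A nonempty \<open>as\<close>
      guarantees two distinct ends; for empty \<open>as\<close> no seam occurs.\<close>
    have seam: "(last (q # bs), hd as) \<in> E" if "as \<noteq> []"
    proof -
      have "hd ps \<noteq> last ps"
        using that ps unfolding split P_def by (cases as) auto
      then show ?thesis using cyc that unfolding split by simp
    qed
    have zs: "distinct ?zs" "set ?zs = set ws \<union> set ps"
      using ws ps unfolding split P_def by auto
    have "successively (\<lambda>x y. (x, y) \<in> E) (ws @ (q # bs) @ as)"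
      using ws ps seam unfolding successively_append_iff[of _ ws] successively_append_iff[of _ "q # bs"]
      by (auto simp: split P_def successively_append_iff)
    then have succ: "successively (\<lambda>x y. (x, y) \<in> E) ?zs" by simp
    have "\<exists>x\<in>set ?zs. x \<in> A" using ws v by force
    then obtain ys x rs where tr: "?zs = ys @ x # rs" "x \<in> A" "\<forall>r\<in>set rs. r \<notin> A"
      using split_list_last_prop[of ?zs "\<lambda>x. x \<in> A"] by blast
    have "hd (ys @ [x]) = hd ?zs" unfolding tr(1) by (cases ys) auto
    then have hd: "hd (ys @ [x]) = v" using ws by simp
    have "distinct (ys @ x # rs)" "successively (\<lambda>x y. (x, y) \<in> E) (ys @ x # rs)"
      using zs(1) succ tr(1) by metis+
    then have "P (ys @ [x])"
      using hd v tr(2) unfolding P_def by (auto simp: successively_append_iff)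
    moreover have "insert v (set ps \<inter> A) \<subseteq> set (ys @ [x])"
    proof -
      have "set ?zs \<inter> A \<subseteq> set (ys @ [x])" unfolding tr(1) using tr(3) by auto
      moreover have "v \<in> set ?zs" using ws by (metis Un_iff hd_in_set set_append)
      ultimately show ?thesis using zs(2) v by blast
    qed
    ultimately show False using no_ext v nv by blast
  qed
  then show thesis using ps that by (auto simp: P_def)
qed

section \<open>Steering a depth first search\<close>

text \<open>Take an extension \<open>zs\<close> inside \<open>C\<close> with the most vertices.
  While \<open>C\<close> is not exhausted, some vertex of \<open>zs\<close>, or else
  \<open>y\<close>, has an unvisited neighbour, and it lies in \<open>C\<close>; visiting it
  contradicts the choice of \<open>zs\<close>.\<close>

lemma dfs_visited_closure:
  assumes "dfs_visited G (xs @ y # ys)"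
    and ys: "\<And>u w. u \<in> set ys \<Longrightarrow> u \<rightarrow>\<^bsub>G\<^esub> w \<Longrightarrow> w \<in> set (xs @ y # ys)"
    and "finite C" "C \<inter> set (xs @ y # ys) = {}"
    and C: "\<And>u w. u \<in> C \<Longrightarrow> u \<rightarrow>\<^bsub>G\<^esub> w \<Longrightarrow> w \<in> C \<union> set (xs @ y # ys)"
    and reach: "\<And>c. c \<in> C \<Longrightarrow> (y, c) \<in> (arcs_ends G \<inter> UNIV \<times> C)\<^sup>*"
  obtains zs where "set zs = C" "dfs_visited G (xs @ y # ys @ zs)"
proof -
  define P where "P zs \<longleftrightarrow> set zs \<subseteq> C \<and> dfs_visited G (xs @ y # ys @ zs)" for zs
  have "P []" using assms(1) by (simp add: P_def)
  moreover have "\<forall>zs. P zs \<longrightarrow> card (set zs) < Suc (card C)"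
    using \<open>finite C\<close> by (auto simp: P_def card_mono le_imp_less_Suc)
  ultimately obtain zs where zs: "P zs"
    and max: "\<And>zs'. P zs' \<Longrightarrow> card (set zs') \<le> card (set zs)"
    using ex_has_greatest_nat[of P "[]" "\<lambda>zs. card (set zs)"] by blast
  have no_ext: "\<not> P (zs @ [w])" if "w \<notin> set zs" for w
    using max[of "zs @ [w]"] that by auto
  have "c \<in> set zs" if c: "c \<in> C" for c
  proof (rule ccontr)
    assume nc: "c \<notin> set zs"
    let ?unv = "\<lambda>u. \<exists>w. u \<rightarrow>\<^bsub>G\<^esub> w \<and> w \<notin> set (xs @ y # ys @ zs)"
    show False
    proof (cases "\<exists>u\<in>set zs. ?unv u")
      case True
      \<comment> \<open>The last such \<open>u\<close> is the one from which the search must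
        continue.\<close>
      then obtain as u bs where split: "zs = as @ u # bs" and u: "?unv u"
        and bs: "\<forall>b\<in>set bs. \<not> ?unv b"
        using split_list_last_prop[of zs ?unv] by blast
      obtain w where w: "u \<rightarrow>\<^bsub>G\<^esub> w" "w \<notin> set (xs @ y # ys @ zs)" using u by blast
      have "w \<in> C" using C[of u w] w zs unfolding P_def split by auto
      moreover have "dfs_visited G ((xs @ y # ys @ as) @ u # bs @ [w])"
        by (rule dfs_visited.step) (use zs w bs split in \<open>auto simp: P_def\<close>)
      ultimately have "P (zs @ [w])" using zs unfolding P_def split by auto
      then show False using no_ext w by auto
    next
      case False
      \<comment> \<open>A walk from \<open>y\<close> through \<open>C\<close> can leave
        \<open>y\<close> and \<open>zs\<close> only by a step from \<open>y\<close>, since the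
        neighbours of \<open>zs\<close> are all visited.\<close>
      have "c \<in> set zs \<union> {y} \<or> (\<exists>w\<in>C. y \<rightarrow>\<^bsub>G\<^esub> w \<and> w \<notin> set zs)"
        using reach[OF c]
      proof (induction rule: rtrancl_induct)
        case (step u w)
        then show ?case using False assms(4) by auto
      qed simp
      then obtain w where w: "w \<in> C" "y \<rightarrow>\<^bsub>G\<^esub> w" "w \<notin> set zs"
        using c nc assms(4) by auto
      have "dfs_visited G (xs @ y # (ys @ zs) @ [w])"
        by (rule dfs_visited.step) (use zs w False assms(4) ys in \<open>auto simp: P_def\<close>)
      then have "P (zs @ [w])" using zs w unfolding P_def by auto
      then show False using no_ext w by auto
    qed
  qed
  then show thesis using zs that by (auto simp: P_def)
qed

text \<open>Intersecting with \<open>UNIV \<times> S\<close> restricts only the targets of steps, so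
  the start may lie outside \<open>S\<close>, as the already visited vertex that the search leaves
  does.\<close>

lemma rtrancl_successively:
  assumes "successively (\<lambda>x y. (x, y) \<in> E) (q # qs)" "set qs \<subseteq> S" "p \<in> set (q # qs)"
  shows "(q, p) \<in> (E \<inter> UNIV \<times> S)\<^sup>*"
  using assms
proof (induction qs arbitrary: q)
  case (Cons r qs)
  show ?case
  proof (cases "p = q")
    case False
    then have "(r, p) \<in> (E \<inter> UNIV \<times> S)\<^sup>*" using Cons by auto
    moreover have "(q, r) \<in> E \<inter> UNIV \<times> S" using Cons.prems by auto
    ultimately show ?thesis by (rule converse_rtrancl_into_rtrancl[rotated])
  qed simp
qed simp

text \<open>Induction on the path still to be descended. The invariant is that \<open>ys\<close> is
  saturated and every unvisited vertex can be reached from \<open>y\<close> through unvisited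
  vertices. Nothing remains after the last vertex, whose neighbours are all visited or on the
  path.\<close>

lemma (in graph) dfs_ordering_along_path:
  assumes "dfs_visited G (xs @ y # ys)"
    and "\<And>u w. u \<in> set ys \<Longrightarrow> u \<rightarrow> w \<Longrightarrow> w \<in> set (xs @ y # ys)"
    and "successively (\<lambda>u v. u \<rightarrow> v) (y # qs)" "distinct qs" "qs \<noteq> []"
    and "set qs \<inter> set (xs @ y # ys) = {}" "set (xs @ y # ys) \<subseteq> verts G"
    and "\<And>w. last qs \<rightarrow> w \<Longrightarrow> w \<in> set (xs @ y # ys) \<union> set qs"
    and "\<And>w. w \<in> verts G - set (xs @ y # ys)
           \<Longrightarrow> (y, w) \<in> (arcs_ends G \<inter> UNIV \<times> (verts G - set (xs @ y # ys)))\<^sup>*"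
  shows "\<exists>zs. dfs_ordering G zs \<and> last zs = last qs"
  using assms
proof (induction qs arbitrary: xs y ys)
  case (Cons q qs)
  note visited = Cons.prems(1) and closed = Cons.prems(2) and path = Cons.prems(3)
    and disj = Cons.prems(6) and nbrs = Cons.prems(8) and reach = Cons.prems(9)
  have sym: "v \<rightarrow> u" if "u \<rightarrow> v" for u v
    using arcs_ends_symmetric[OF sym_arcs that] .
  define U where "U = verts G - set (xs @ y # ys)"
  \<comment> \<open>\<open>K\<close> collects the unvisited components that meet the remaining path;
    \<open>C\<close>, the others, must be exhausted before moving on to \<open>q\<close>.\<close>
  define K where "K = {c \<in> U. \<exists>p \<in> set (q # qs). (p, c) \<in> (arcs_ends G \<inter> UNIV \<times> U)\<^sup>*}"
  define C where "C = U - K"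
  have K_step: "d \<in> K" if "c \<in> K" "c \<rightarrow> d" "d \<in> U" for c d
    using that unfolding K_def by (auto intro: rtrancl_into_rtrancl)
  have qsU: "set (q # qs) \<subseteq> U"
  proof
    fix p assume p: "p \<in> set (q # qs)"
    have "(y, p) \<in> (arcs_ends G \<inter> UNIV \<times> set (q # qs))\<^sup>*"
      using rtrancl_successively[OF path, of "set (q # qs)" p] p by auto
    then have "p = y \<or> p \<in> verts G"
      by (cases rule: rtrancl.cases) (auto dest: adj_in_verts)
    then show "p \<in> U" using p disj unfolding U_def by auto
  qed
  then have qsK: "set (q # qs) \<subseteq> K" by (auto simp: K_def)
  \<comment> \<open>By symmetry, a vertex with a neighbour in \<open>K\<close> would itself lie in
    \<open>K\<close> if unvisited.\<close>
  have C_nbrs: "w \<in> C \<union> set (xs @ y # ys)" if "u \<in> C" "u \<rightarrow> w" for u w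
    using that K_step[of w u] sym adj_in_verts(2)[of u w] by (auto simp: C_def U_def)
  have C_reach: "(y, c) \<in> (arcs_ends G \<inter> UNIV \<times> C)\<^sup>*" if c: "c \<in> C" for c
  proof -
    have "(y, c) \<in> (arcs_ends G \<inter> UNIV \<times> U)\<^sup>*"
      using reach c unfolding C_def U_def by blast
    \<comment> \<open>A walk through \<open>U\<close> that has entered \<open>K\<close> never leaves
      it, so a walk ending in \<open>C\<close> has avoided \<open>K\<close>.\<close>
    then have "c \<in> K \<or> (y, c) \<in> (arcs_ends G \<inter> UNIV \<times> C)\<^sup>*"
    proof (induction rule: rtrancl_induct)
      case (step c d)
      show ?case
      proof (cases "d \<in> K")
        case False
        then have "d \<in> C" "c \<notin> K" using step K_step by (auto simp: C_def)
        then show ?thesis using step by (auto intro: rtrancl_into_rtrancl)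
      qed simp
    qed simp
    then show ?thesis using c by (simp add: C_def)
  qed
  have "finite C" "C \<inter> set (xs @ y # ys) = {}" by (auto simp: C_def U_def)
  note C_props = closed this C_nbrs C_reach
  obtain zs where zs: "set zs = C" "dfs_visited G (xs @ y # ys @ zs)"
    by (rule dfs_visited_closure[OF visited, where C = C]) (assumption | rule C_props that)+
  have "dfs_visited G (xs @ y # (ys @ zs) @ [q])"
  proof (rule dfs_visited.step)
    show "dfs_visited G (xs @ y # ys @ zs)" by fact
    show "\<forall>u\<in>set (ys @ zs). \<forall>w. u \<rightarrow> w \<longrightarrow> w \<in> set (xs @ y # ys @ zs)"
      using closed C_nbrs zs(1)
      by fastforce
    show "y \<rightarrow> q" using path by simp
    show "q \<notin> set (xs @ y # ys @ zs)"
      using disj qsK zs(1) by (auto simp: C_def)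
  qed
  then have visited': "dfs_visited G ((xs @ y # ys @ zs) @ q # [])" by simp
  have rest: "verts G - set ((xs @ y # ys @ zs) @ q # []) = K - {q}"
    using zs(1) by (auto simp: C_def K_def U_def)
  have sub: "set ((xs @ y # ys @ zs) @ q # []) \<subseteq> verts G"
    using Cons.prems(7) qsU zs(1) by (auto simp: C_def U_def)
  show ?case
  proof (cases "qs = []")
    case True
    \<comment> \<open>Here \<open>q\<close> ends the path, so its only possible unvisited neighbour
      would be \<open>q\<close> itself: \<open>K\<close> shrinks to \<open>q\<close>.\<close>
    have "c = q" if "(q, c) \<in> (arcs_ends G \<inter> UNIV \<times> U)\<^sup>*" for c
      using that
    proof (induction rule: rtrancl_induct)
      case (step c d)
      then show ?case using nbrs[of d] True by (auto simp: U_def)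
    qed simp
    then have "K \<subseteq> {q}" using True by (auto simp: K_def)
    then have "set ((xs @ y # ys @ zs) @ q # []) = verts G" using rest sub by blast
    then show ?thesis using visited' True
      by (intro exI[of _ "(xs @ y # ys @ zs) @ q # []"]) (auto simp: dfs_ordering_def)
  next
    case False
    \<comment> \<open>This restores the invariant at \<open>q\<close>: follow the path to
      \<open>p\<close>, then the walk in \<open>U\<close>, starting afresh whenever it returns to
      \<open>q\<close>.\<close>
    have "(q, w) \<in> (arcs_ends G \<inter> UNIV \<times> (K - {q}))\<^sup>*" if "w \<in> K" for w
    proof -
      obtain p where p: "p \<in> set (q # qs)" and "(p, w) \<in> (arcs_ends G \<inter> UNIV \<times> U)\<^sup>*"
        using \<open>w \<in> K\<close> unfolding K_def by blast
      from this(2) have "w \<in> K \<and> (q, w) \<in> (arcs_ends G \<inter> UNIV \<times> (K - {q}))\<^sup>*"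
      proof (induction rule: rtrancl_induct)
        case base
        have "set qs \<subseteq> K - {q}" using qsK Cons.prems(4) by auto
        then show ?case
          using rtrancl_successively[of _ q qs, OF _ _ p] path qsK p by auto
      next
        case (step c d)
        then have "d \<in> K" using K_step by auto
        then show ?case using step by (cases "d = q") (auto intro: rtrancl_into_rtrancl)
      qed
      then show ?thesis by blast
    qed
    moreover have "successively (\<lambda>u v. u \<rightarrow> v) (q # qs)" "distinct qs"
      using path Cons.prems(4) by simp_all
    moreover have "set qs \<inter> set ((xs @ y # ys @ zs) @ q # []) = {}"
      using disj qsK zs(1) Cons.prems(4) by (auto simp: C_def)
    moreover have "w \<in> set ((xs @ y # ys @ zs) @ q # []) \<union> set qs" if "last qs \<rightarrow> w" for w
      using nbrs[of w] that False by auto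
    ultimately have "\<exists>us. dfs_ordering G us \<and> last us = last qs"
      by (intro Cons.IH[OF visited' _ _ _ False _ sub]) (unfold rest, simp_all)
    then show ?thesis using False by simp
  qed
qed simp

section \<open>Depth first search and cut vertices\<close>

text \<open>Each new vertex is adjacent to an earlier one. Applied to a complete search without its
  last vertex \<open>t\<close>, this connects \<open>G - t\<close>.\<close>

lemma dfs_visited_reachable:
  assumes "dfs_visited G xs"
  shows "xs \<noteq> [] \<and> (\<forall>v \<in> set xs. (hd xs, v) \<in> (arcs_ends G \<inter> set xs \<times> set xs)\<^sup>*)"
  using assms
proof induction
  case (step xs y ys z)
  let ?xs = "xs @ y # ys"
  let ?E = "\<lambda>xs. arcs_ends G \<inter> set xs \<times> set xs"
  have "(?E ?xs)\<^sup>* \<subseteq> (?E (?xs @ [z]))\<^sup>*" by (rule rtrancl_mono) auto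
  then have *: "(hd ?xs, v) \<in> (?E (?xs @ [z]))\<^sup>*" if "v \<in> set ?xs" for v
    using step.IH that by blast
  have "(hd ?xs, z) \<in> (?E (?xs @ [z]))\<^sup>*"
    by (rule rtrancl_into_rtrancl[OF *[of y]]) (use step in auto)
  with * show ?case by (auto simp: hd_append)
qed simp

theorem theorem19:
  fixes G :: "('a, 'b) pre_digraph" and t :: 'a
  assumes "graph G"
    and "connected G"
    and "induced_free (with_proj claw) G"
    and "induced_free (with_proj net) G"
    and "t \<in> verts G"
  shows "(\<exists>xs. dfs_ordering G xs \<and> last xs = t) \<longleftrightarrow> \<not> cut_vertex G t"
proof -
  interpret graph G by fact
  have sym: "sym (arcs_ends G)" using sym_arcs by (simp add: symmetric_def)
  have G_conn: "(u, v) \<in> (arcs_ends G)\<^sup>*" if "u \<in> verts G" "v \<in> verts G" for u v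
    using that assms(2) symmetric_connected_iff[OF wf_digraph sym_arcs] by blast
  let ?H = "del_vert t"
  have H_conn: "connected ?H \<longleftrightarrow>
    verts ?H \<noteq> {} \<and> (\<forall>u \<in> verts ?H. \<forall>v \<in> verts ?H. (u, v) \<in> (arcs_ends ?H)\<^sup>*)"
    by (intro symmetric_connected_iff wf_digraph_del_vert symmetric_del_vert sym_arcs)
  have H_sym: "sym (arcs_ends ?H)"
    using symmetric_del_vert[OF sym_arcs] by (simp add: symmetric_def)
  show ?thesis
  proof
    assume "\<exists>xs. dfs_ordering G xs \<and> last xs = t"
    then obtain xs where xs: "dfs_visited G xs" "set xs = verts G" "last xs = t"
      by (auto simp: dfs_ordering_def)
    from xs(1) show "\<not> cut_vertex G t"
    proof cases
      \<comment> \<open>Here \<open>t\<close> is the only vertex, and an empty remainder does not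
        count as disconnected.\<close>
      case (start s)
      then show ?thesis using xs by (auto simp: cut_vertex_def del_vert_simps)
    next
      case (step us y ys z)
      let ?us = "us @ y # ys"
      have us: "verts ?H = set ?us"
        using step xs by (auto simp: del_vert_simps)
      have sub: "arcs_ends G \<inter> set ?us \<times> set ?us \<subseteq> arcs_ends ?H"
        unfolding us[symmetric] by (auto simp: arcs_ends_del_vert del_vert_simps)
      have "(hd ?us, v) \<in> (arcs_ends ?H)\<^sup>*" if "v \<in> verts ?H" for v
        using dfs_visited_reachable[OF step(2)] that rtrancl_mono[OF sub] unfolding us by blast
      then have "(u, v) \<in> (arcs_ends ?H)\<^sup>*" if "u \<in> verts ?H" "v \<in> verts ?H" for u v
        using that sym_rtrancl[OF H_sym] by (meson rtrancl_trans symD)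
      then have "connected ?H" unfolding H_conn using us by auto
      then show ?thesis by (simp add: cut_vertex_def)
    qed
  next
    assume ncut: "\<not> cut_vertex G t"
    define A where "A = {v. t \<rightarrow>\<^bsub>G\<^esub> v}"
    have AH: "A \<subseteq> verts ?H"
      using adj_in_verts adj_not_same by (auto simp: A_def del_vert_simps)
    show "\<exists>xs. dfs_ordering G xs \<and> last xs = t"
    \<comment> \<open>An isolated \<open>t\<close> is all of the connected graph. Otherwise
      \<open>G - t\<close> has a vertex, and not being a cut vertex means that \<open>G - t\<close>
      is connected.\<close>
    proof (cases "A = {}")
      case True
      have "v = t" if "v \<in> verts G" for v
        using G_conn[OF assms(5) that] True by (auto simp: A_def elim: converse_rtranclE)
      then have "verts G = {t}" using assms(5) by blast
      then have "dfs_ordering G [t]"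
        using dfs_visited.start[OF assms(5)] by (simp add: dfs_ordering_def)
      then show ?thesis by (intro exI[of _ "[t]"]) simp
    next
      case False
      then have "connected ?H" using ncut AH assms(5) by (auto simp: cut_vertex_def)
      then have A_conn: "(u, v) \<in> (arcs_ends ?H)\<^sup>*" if "u \<in> A" "v \<in> A" for u v
        using that AH unfolding H_conn by blast
      have A_indep: "(x, y) \<in> arcs_ends ?H \<or> (y, z) \<in> arcs_ends ?H \<or> (x, z) \<in> arcs_ends ?H"
        if "x \<in> A" "y \<in> A" "z \<in> A" "x \<noteq> y" "y \<noteq> z" "x \<noteq> z" for x y z
        using claw_free_neighbours[OF assms(3), of t x y z] that AH
        by (auto simp: A_def arcs_ends_del_vert del_vert_simps)
      have "finite A" using AH finite_subset by (fastforce simp: del_vert_simps)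
      from path_through_set[OF this False A_conn H_sym A_indep]
      obtain ps where ps: "ps \<noteq> []" "distinct ps"
        "successively (\<lambda>x y. (x, y) \<in> arcs_ends ?H) ps" "A \<subseteq> set ps" "last ps \<in> A"
        by blast
      obtain s qs where s: "ps = s # qs" using ps(1) by (cases ps) auto
      have t: "last ps \<rightarrow>\<^bsub>G\<^esub> t" using ps(5) sym by (auto simp: A_def dest: symD)
      have "successively (\<lambda>u v. u \<rightarrow>\<^bsub>G\<^esub> v) ps"
        using ps(3) by (rule successively_mono) (simp add: arcs_ends_del_vert)
      with t have path: "successively (\<lambda>u v. u \<rightarrow>\<^bsub>G\<^esub> v) (ps @ [t])"
        by (simp add: successively_append_iff)
      \<comment> \<open>Every vertex of \<open>ps\<close> but the last has an outgoing arc in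
        \<open>G - t\<close>, and the last lies in \<open>A\<close>.\<close>
      have "t \<notin> set ps"
      proof
        assume "t \<in> set ps"
        then obtain as bs where split: "ps = as @ t # bs" by (meson split_list)
        have "last ps \<noteq> t" using ps(5) AH by (auto simp: del_vert_simps)
        then have "bs \<noteq> []" using split by auto
        then show False
          using ps(3) unfolding split
          by (cases bs) (auto simp: successively_append_iff arcs_ends_del_vert)
      qed
      have sV: "s \<in> verts G"
        using path s adj_in_verts(1) by (cases qs) auto
      \<comment> \<open>The initial invariant for a search started at \<open>s\<close>: a walk from
        \<open>s\<close> is restarted at each return to \<open>s\<close>.\<close>
      have "(s, w) \<in> (arcs_ends G \<inter> UNIV \<times> (verts G - {s}))\<^sup>*" if "w \<in> verts G" for w
        using G_conn[OF sV that]
      proof (induction rule: rtrancl_induct)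
        case (step v w)
        then show ?case
          using adj_in_verts(2)[of v w] by (cases "w = s") (auto intro: rtrancl_into_rtrancl)
      qed simp
      \<comment> \<open>The search descends along \<open>ps\<close> to \<open>t\<close>; since
        \<open>ps\<close> contains \<open>A\<close>, no neighbour of \<open>t\<close> is left
        over.\<close>
      then have "\<exists>zs. dfs_ordering G zs \<and> last zs = last (qs @ [t])"
        using path ps sV \<open>t \<notin> set ps\<close> unfolding s
        by (intro dfs_ordering_along_path[of "[]" s "[]"])
          (auto simp: A_def intro: dfs_visited.start)
      then show ?thesis by simp
    qed
  qed
qed

end
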